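(* For every $n \geq 1$ there is a closed $n$-productive but not $(n+1)$-productive maximal eventually different family, and there is a closed finitely productive maximal eventually different family.
   Context: For countable sets $A,B$ and $f,g \in {}^{A}B$ (functions from $A$ to $B$) let $E(f,g) := \{a \in A \mid f(a) = g(a)\}$; $f$ and $g$ are eventually different if $E(f,g)$ is finite. A family $\mathcal{F} \subseteq {}^{A}B$ is eventually different (ed) if its members are pairwise eventually different, and it is maximal eventually different (med) if it is maximal with respect to inclusion among ed families contained in ${}^{A}B$. For functions $f_1,\dots,f_n$ with the same domain, $(f_1\times\dots\times f_n)(a) := (f_1(a),\dots,f_n(a))$. For a family $\mathcal{F} \subseteq {}^{A}B$ and $n \geq 1$, $\mathcal{F}^n := \{f_1 \times \dots \times f_n \mid f_1,\dots,f_n \in \mathcal{F}\} \subseteq {}^{A}(B^n)$. A med family $\mathcal{F}\subseteq {}^{A}B$ is $n$-productive if $\mathcal{F}^n$ is a med family in ${}^{A}(B^n)$, and finitely productive if it is $n$-productive for all $n \geq 1$. Here the families consist of functions from $\omega$ to $\omega$, and "closed" refers to the product topology on ${}^{\omega}\omega$ with $\omega$ discrete. *)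

theory Defs
  imports "HOL-Analysis.Function_Topology"
begin

text \<open>
  The functions from \<open>A\<close> to \<open>B\<close> are the extensional ones, \<open>A \<rightarrow>\<^sub>E B\<close>.  The definitions
  make sense for arbitrary sets; the intended ones are countable.
\<close>

definition agreement :: "'a set \<Rightarrow> ('a \<Rightarrow> 'b) \<Rightarrow> ('a \<Rightarrow> 'b) \<Rightarrow> 'a set" where
  "agreement A f g = {a \<in> A. f a = g a}"

definition eventually_different :: "'a set \<Rightarrow> ('a \<Rightarrow> 'b) \<Rightarrow> ('a \<Rightarrow> 'b) \<Rightarrow> bool" where
  "eventually_different A f g \<longleftrightarrow> finite (agreement A f g)"

definition ed_family :: "'a set \<Rightarrow> 'b set \<Rightarrow> ('a \<Rightarrow> 'b) set \<Rightarrow> bool" where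
  "ed_family A B F \<longleftrightarrow> F \<subseteq> (A \<rightarrow>\<^sub>E B) \<and> pairwise (eventually_different A) F"

definition med_family :: "'a set \<Rightarrow> 'b set \<Rightarrow> ('a \<Rightarrow> 'b) set \<Rightarrow> bool" where
  "med_family A B F \<longleftrightarrow>
     ed_family A B F \<and> (\<forall>G. ed_family A B G \<and> F \<subseteq> G \<longrightarrow> G = F)"

text \<open>The power \<open>B\<^sup>n\<close> is encoded as the set of lists of length \<open>n\<close> over \<open>B\<close>.\<close>

definition tuples :: "nat \<Rightarrow> 'b set \<Rightarrow> 'b list set" where
  "tuples n B = {xs. length xs = n \<and> set xs \<subseteq> B}"

definition fun_product :: "'a set \<Rightarrow> ('a \<Rightarrow> 'b) list \<Rightarrow> 'a \<Rightarrow> 'b list" where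
  "fun_product A fs = (\<lambda>a\<in>A. map (\<lambda>f. f a) fs)"

definition family_power :: "'a set \<Rightarrow> ('a \<Rightarrow> 'b) set \<Rightarrow> nat \<Rightarrow> ('a \<Rightarrow> 'b list) set" where
  "family_power A F n = fun_product A ` tuples n F"

definition productive :: "nat \<Rightarrow> 'a set \<Rightarrow> 'b set \<Rightarrow> ('a \<Rightarrow> 'b) set \<Rightarrow> bool" where
  "productive n A B F \<longleftrightarrow>
     med_family A B F \<and> med_family A (tuples n B) (family_power A F n)"

definition finitely_productive :: "'a set \<Rightarrow> 'b set \<Rightarrow> ('a \<Rightarrow> 'b) set \<Rightarrow> bool" where
  "finitely_productive A B F \<longleftrightarrow> (\<forall>n\<ge>1. productive n A B F)"

definition closed_family :: "(nat \<Rightarrow> nat) set \<Rightarrow> bool" where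
  "closed_family F \<longleftrightarrow> closedin (product_topology (\<lambda>_. discrete_topology UNIV) UNIV) F"

end

theory Submission
  imports Defs
begin

text \<open>
  For \<open>n \<ge> 1\<close>, a family of functions \<open>\<nat> \<rightarrow> \<nat>\<close> has a maximal eventually different \<open>n\<close>-th power exactly
  if it is eventually different and every \<open>h : \<nat> \<rightarrow> \<nat>\<^sup>n\<close> is \<^emph>\<open>caught\<close>: some tuple from the
  family agrees with \<open>h\<close> in all coordinates at infinitely many places simultaneously
  (\<open>med_family_iff\<close>, \<open>ed_family_power\<close>).  The proof constructs one family per set \<open>J\<close> of
  admitted coordinates, and takes \<open>J = {0, \<dots>, n - 1}\<close> for the first claim and \<open>J = \<nat>\<close> for
  the second.

  By default the value at \<open>n\<close> of the member with parameters \<open>x\<close>, \<open>j\<close>, \<open>r\<close> is a code of \<open>j\<close>,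
  \<open>r\<close> and the first \<open>n\<close> entries of \<open>x\<close>.  This alone gives a closed eventually different family.
  To make it catch tuples, each \<open>x\<close> is read as a list-valued function \<open>h\<close> together with
  auxiliary data.  The prefixes of \<open>h\<close> determine places \<open>slot h k\<close>, and at some of them the
  members \<open>j = 0, 1, \<dots>\<close> over \<open>x\<close> take the entries of \<open>h\<close> for their values.  Different \<open>h\<close> share
  only finitely many slots.  Eventual difference is still in danger if different \<open>x\<close> over the
  same \<open>h\<close> substitute at infinitely many common slots, if entries are repeated within a
  list, or if infinitely many substituted entries are codes of one and the same parameters.

  The last danger is avoided by a Ramsey argument.  Colour a pair of slots by the set of
  coordinates whose two entries are codes of common parameters (\<open>coherent\<close>).  The auxiliary
  data single out a branch of the Erdos-Rado tree of this colouring: a set of slots on which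
  the colour of a pair depends only on the smaller slot.  A coordinate is substituted only where
  that colour calls it incoherent, so no parameters are hit twice.  The tree
  replaces the free choice of an infinite homogeneous set, which would let different \<open>x\<close>
  over the same \<open>h\<close> substitute at infinitely many common slots: two different branches meet in
  a finite set (\<open>paths_almost_disjoint\<close>).  Membership in a branch is decided by a finite part of
  \<open>x\<close>, which makes the family closed.

  Given \<open>h\<close>, there is an infinite branch (\<open>path_over\<close>), and infinitely many of its slots have the
  same colour.  There the coordinates called incoherent are caught by substitution.  Each
  remaining coordinate either repeats an earlier one or consists of codes of a single triple of
  parameters (\<open>coherent_limit\<close>), hence is caught by the member with these parameters, unless
  that member abandons its own code at these places.  For this case a substitution shifts codes as
  in Hilbert's hotel: where the member with \<open>r = 0\<close> gives up its code, the member with \<open>r = 1\<close>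
  takes it over, \<open>r = 2\<close> takes over the code of \<open>r = 1\<close>, and so on, so every code remains the
  value of some member (\<open>family_catches\<close>).

  For \<open>J = {0, \<dots>, n - 1}\<close> the constant tuple \<open>(0, 1, \<dots>, n)\<close> is not caught: a constant is a
  code of given parameters at most once, so all its coordinates would be caught by substitution at
  infinitely many common slots, hence by \<open>n + 1\<close> different members over the same \<open>x\<close>, which
  offers only \<open>n\<close> coordinates (\<open>family_not_productive\<close>).
\<close>

section \<open>Codes of parameters\<close>

text \<open>
  The first component is the tuple function to be caught.  The second one is a sequence of guesses:
  \<open>Some c\<close> at \<open>k\<close> asserts that \<open>k\<close> lies on the branch, and that \<open>c\<close> is the colour of
  the pairs formed by \<open>k\<close> and the later points of the branch.
\<close>

type_synonym index = "nat \<Rightarrow> nat list \<times> bool list option"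

definition code :: "index \<Rightarrow> nat \<Rightarrow> nat \<Rightarrow> nat \<Rightarrow> nat" where
  "code x j r n = to_nat (j, r, map x [0..<n])"

lemma map_upt_eq_iff: "map f [0..<n] = map g [0..<n] \<longleftrightarrow> (\<forall>i<n. f i = g i)"
  by (auto simp: list_eq_iff_nth_eq)

lemma code_eq_iff:
  "code x j r n = code x' j' r' n' \<longleftrightarrow> n = n' \<and> j = j' \<and> r = r' \<and> (\<forall>i<n. x i = x' i)"
proof -
  have "map x [0..<n] = map x' [0..<n'] \<Longrightarrow> n = n'"
    by (drule arg_cong[where f = length]) simp
  then show ?thesis
    by (auto simp: code_def map_upt_eq_iff)
qed

lemma codes_agree_infinitely:
  assumes "infinite {n. code x j r n = code x' j' r' n}"
  shows "x = x' \<and> j = j' \<and> r = r'"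
proof -
  have "x i = x' i" for i
    using assms by (auto simp: infinite_nat_iff_unbounded code_eq_iff)
  moreover have "j = j' \<and> r = r'"
    using assms by (auto simp: infinite_nat_iff_unbounded code_eq_iff)
  ultimately show ?thesis by auto
qed

text \<open>
  Two values at two places are coherent if one default function passes through both.
\<close>

definition coherent :: "nat \<Rightarrow> nat \<Rightarrow> nat \<Rightarrow> nat \<Rightarrow> bool" where
  "coherent m v n w \<longleftrightarrow> (\<exists>y j r. v = code y j r m \<and> w = code y j r n)"

lemma coherent_sym: "coherent m v n w \<Longrightarrow> coherent n w m v"
  by (auto simp: coherent_def)

text \<open>
  Parameters that code a value at \<open>n\<close> are determined below \<open>n\<close> by that value, so pairwise
  coherent values determine ever longer prefixes of the same parameters.
\<close>

lemma coherent_limit: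
  assumes M: "infinite M"
    and coh: "\<And>m n. m \<in> M \<Longrightarrow> n \<in> M \<Longrightarrow> m < n \<Longrightarrow> coherent m (v m) n (v n)"
  shows "\<exists>y j r. \<forall>n\<in>M. v n = code y j r n"
proof -
  have next_above: "\<exists>n\<in>M. i < n" for i
    using M by (auto simp: infinite_nat_iff_unbounded)
  have "\<exists>Y J R. v n = code Y J R n" if "n \<in> M" for n
    using next_above[of n] coh[OF that] by (force simp: coherent_def)
  then obtain Y J R where rep: "\<And>n. n \<in> M \<Longrightarrow> v n = code (Y n) (J n) (R n) n"
    by metis
  have agree: "J m = J n \<and> R m = R n \<and> (\<forall>i<m. Y m i = Y n i)"
    if "m \<in> M" "n \<in> M" "m < n" for m n
    using coh[OF that] that(3) unfolding rep[OF that(1)] rep[OF that(2)]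
    by (auto simp: coherent_def code_eq_iff)
  have agree': "J m = J n \<and> R m = R n \<and> (\<forall>i. i < m \<and> i < n \<longrightarrow> Y m i = Y n i)"
    if "m \<in> M" "n \<in> M" for m n
  proof (cases m n rule: linorder_cases)
    case less
    from agree[OF that less] show ?thesis by blast
  next
    case greater
    from agree[OF that(2,1) greater] show ?thesis by metis
  qed simp
  obtain above where above: "\<And>i. above i \<in> M" "\<And>i. i < above i"
    using next_above by metis
  define y where "y i = Y (above i) i" for i
  have "v n = code y (J (above 0)) (R (above 0)) n" if "n \<in> M" for n
    unfolding rep[OF that] code_eq_iff y_def
    using agree'[OF that above(1)] above(2) by blast
  then show ?thesis by blast
qed

section \<open>Slots and the colouring of pairs\<close>

text \<open>
  Slots are odd, so the even places carry unmodified codes, from which a limit of members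
  recovers its parameters.  The pairing with \<open>k\<close> makes a slot larger than its index.
\<close>

definition slot :: "(nat \<Rightarrow> nat list) \<Rightarrow> nat \<Rightarrow> nat" where
  "slot h k = Suc (2 * prod_encode (k, to_nat (map h [0..<k])))"

lemma slot_eq_iff: "slot h k = slot h' k' \<longleftrightarrow> k = k' \<and> (\<forall>i<k. h i = h' i)"
  by (auto simp: slot_def map_upt_eq_iff)

lemma slot_cong: "(\<And>i. i < k \<Longrightarrow> h i = h' i) \<Longrightarrow> slot h k = slot h' k"
  by (simp add: slot_eq_iff)

lemma odd_slot: "odd (slot h k)"
  by (simp add: slot_def)

lemma less_slot: "k < slot h k"
  using le_prod_encode_1[of k "to_nat (map h [0..<k])"] by (simp add: slot_def)

lemma inj_slot: "inj (slot h)"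
  by (simp add: inj_def slot_eq_iff)

text \<open>
  Entry \<open>i\<close> of a colour is true if coordinate \<open>i\<close> is not to be substituted, either because its
  entry is coherent with the later one or because an earlier coordinate has the same entry,
  in which case substituting both would make two members agree.
\<close>

definition color :: "(nat \<Rightarrow> nat list) \<Rightarrow> nat \<Rightarrow> nat \<Rightarrow> bool list" where
  "color h k l =
     map (\<lambda>i. h (slot h k) ! i \<in> set (take i (h (slot h k))) \<or>
              coherent (slot h k) (h (slot h k) ! i) (slot h l) (h (slot h l) ! i))
       [0..<length (h (slot h k))]"

lemma finite_range_color: "finite (range (color h k))"
proof (rule finite_subset)
  show "range (color h k) \<subseteq> {c. set c \<subseteq> UNIV \<and> length c = length (h (slot h k))}"
    by (auto simp: color_def)
  show "finite \<dots>" by (rule finite_lists_length_eq) simp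
qed

section \<open>Branches of the Erdos-Rado tree\<close>

definition follows :: "index \<Rightarrow> nat \<Rightarrow> bool" where
  "follows x l \<longleftrightarrow> (\<forall>k<l. \<forall>c. snd (x k) = Some c \<longrightarrow> color (fst \<circ> x) k l = c)"

text \<open>
  The equivalence is what makes branches almost disjoint: an index may be left out of the branch
  only if it violates an earlier guess, so the guesses determine which indices belong to it.
\<close>

definition on_path :: "index \<Rightarrow> nat \<Rightarrow> bool" where
  "on_path x l \<longleftrightarrow> snd (x l) \<noteq> None \<and> (\<forall>k\<le>l. snd (x k) \<noteq> None \<longleftrightarrow> follows x k)"

lemma on_path_Some: "on_path x l \<Longrightarrow> \<exists>c. snd (x l) = Some c"
  unfolding on_path_def by (drule conjunct1) simp

lemma on_path_follows: "on_path x l \<Longrightarrow> follows x l"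
  unfolding on_path_def using le_refl by blast

text \<open>
  A common slot \<open>l\<close> forces the first components to agree below \<open>l\<close>.  At the first index \<open>k\<close>
  where the guesses differ, both branches contain \<open>k\<close> but assign to it different colours, and
  no later \<open>l\<close> can have both colours with \<open>k\<close>.
\<close>

lemma paths_almost_disjoint:
  assumes inf: "infinite {n. (\<exists>l. n = slot (fst \<circ> x) l \<and> on_path x l) \<and>
                             (\<exists>l. n = slot (fst \<circ> y) l \<and> on_path y l)}"
  shows "x = y"
proof -
  define L where "L = {l. slot (fst \<circ> x) l = slot (fst \<circ> y) l \<and> on_path x l \<and> on_path y l}"
  have "{n. (\<exists>l. n = slot (fst \<circ> x) l \<and> on_path x l) \<and>
            (\<exists>l. n = slot (fst \<circ> y) l \<and> on_path y l)} \<subseteq> slot (fst \<circ> x) ` L"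
    by (auto simp: L_def slot_eq_iff image_def)
  with inf have "infinite L"
    by (meson finite_imageI finite_subset)
  then have unbounded: "\<exists>l\<in>L. k < l" for k
    by (auto simp: infinite_nat_iff_unbounded)
  have "fst (x k) = fst (y k)" for k
    using unbounded[of k] by (auto simp: L_def slot_eq_iff)
  then have fst_eq: "fst \<circ> x = fst \<circ> y" by auto
  have "snd (x k) = snd (y k)" for k
  proof (induction k rule: less_induct)
    case (less k)
    obtain l where l: "k < l" "on_path x l" "on_path y l"
      using unbounded[of k] by (auto simp: L_def)
    have "follows x k \<longleftrightarrow> follows y k"
      using less by (simp add: follows_def fst_eq)
    then have "snd (x k) = None \<longleftrightarrow> snd (y k) = None"
      using l less_imp_le unfolding on_path_def by blast
    moreover have "c = c'" if "snd (x k) = Some c" "snd (y k) = Some c'" for c c'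
    proof -
      have "follows x l" "follows y l"
        using l(2,3) by (auto intro: on_path_follows)
      then have "color (fst \<circ> x) k l = c" "color (fst \<circ> y) k l = c'"
        using that l(1) unfolding follows_def by blast+
      with fst_eq show ?thesis by simp
    qed
    ultimately show ?case
      by (metis option.exhaust)
  qed
  with fst_eq show ?thesis
    by (auto simp: fun_eq_iff intro: prod_eqI)
qed

text \<open>
  Compactness of a product of finite sets: the functions \<open>\<lambda>k. c k l\<close>, for \<open>l\<close> tending to
  infinity, have a cluster point.
\<close>

lemma limit_coloring:
  fixes c :: "nat \<Rightarrow> nat \<Rightarrow> 'c"
  assumes "\<And>k. finite (range (c k))"
  shows "\<exists>a. \<forall>m. infinite {l. \<forall>k<m. c k l = a k}"
proof -
  have step: "\<exists>B. infinite B \<and> B \<subseteq> A \<and> (\<exists>b. \<forall>l\<in>B. c m l = b)" if "infinite A" for A m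
  proof -
    have "finite (c m ` A)"
      using assms by (rule finite_subset[rotated]) auto
    from pigeonhole_infinite[OF that this] obtain l where "infinite {i \<in> A. c m i = c m l}"
      by auto
    then show ?thesis by (intro exI[of _ "{i \<in> A. c m i = c m l}"]) auto
  qed
  have "\<exists>A. \<forall>m. infinite (A m) \<and> A (Suc m) \<subseteq> A m \<and> (\<exists>b. \<forall>l\<in>A (Suc m). c m l = b)"
    using dependent_nat_choice[of "\<lambda>_ A. infinite A"
        "\<lambda>m A B. B \<subseteq> A \<and> (\<exists>b. \<forall>l\<in>B. c m l = b)"] step infinite_UNIV_nat
    by metis
  then obtain A a where A: "\<And>m. infinite (A m)" "\<And>m. A (Suc m) \<subseteq> A m"
    and a: "\<And>m l. l \<in> A (Suc m) \<Longrightarrow> c m l = a m"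
    by metis
  have "c k l = a k" if "l \<in> A m" "k < m" for k l m
    using lift_Suc_antimono_le[of A "Suc k" m, OF A(2)] a that by auto
  then have "A m \<subseteq> {l. \<forall>k<m. c k l = a k}" for m
    by auto
  with A(1) show ?thesis by (meson finite_subset)
qed

fun branch :: "(nat \<Rightarrow> nat \<Rightarrow> 'c) \<Rightarrow> (nat \<Rightarrow> 'c) \<Rightarrow> nat \<Rightarrow> bool" where
  "branch c a l \<longleftrightarrow> (\<forall>k\<in>{..<l}. branch c a k \<longrightarrow> c k l = a k)"

declare branch.simps [simp del]

text \<open>
  If no branch point lay above \<open>m\<close>, then any \<open>l > m\<close> that realises the guesses up to \<open>m\<close>
  would be one.
\<close>

lemma infinite_branch:
  assumes "\<And>m. infinite {l. \<forall>k<m. c k l = a k}"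
  shows "infinite {l. branch c a l}"
  unfolding infinite_nat_iff_unbounded
proof
  fix m
  obtain l where l: "m < l" "\<forall>k<Suc m. c k l = a k"
    using assms[of "Suc m"] by (auto simp: infinite_nat_iff_unbounded)
  show "\<exists>n>m. n \<in> {l. branch c a l}"
  proof (rule ccontr)
    assume none: "\<not> ?thesis"
    then have "branch c a l"
      unfolding branch.simps[of c a l] using l(2) by (metis less_Suc_eq_le linorder_not_le mem_Collect_eq)
    with none l(1) show False by auto
  qed
qed

lemma path_over:
  fixes h :: "nat \<Rightarrow> nat list"
  shows "\<exists>x. fst \<circ> x = h \<and> infinite {l. on_path x l}"
proof -
  obtain a where a: "\<And>m. infinite {l. \<forall>k<m. color h k l = a k}"
    using limit_coloring[of "color h"] finite_range_color by blast
  define x where "x l = (h l, if branch (color h) a l then Some (a l) else None)" for l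
  have fst_x: "fst \<circ> x = h"
    by (auto simp: x_def)
  have "follows x l \<longleftrightarrow> branch (color h) a l" for l
    unfolding follows_def fst_x branch.simps[of _ _ l] by (auto simp: x_def)
  then have "on_path x l \<longleftrightarrow> branch (color h) a l" for l
    by (auto simp: on_path_def x_def)
  with infinite_branch[OF a] fst_x show ?thesis by auto
qed

section \<open>The family\<close>

definition used :: "nat set \<Rightarrow> index \<Rightarrow> nat \<Rightarrow> nat \<Rightarrow> bool" where
  "used J x j n \<longleftrightarrow> j \<in> J \<and>
     (\<exists>l c. n = slot (fst \<circ> x) l \<and> on_path x l \<and> snd (x l) = Some c \<and> j < length c \<and> \<not> c ! j)"

text \<open>
  The third parameter exists only to keep every code in use: at a place where the member with
  \<open>r = 0\<close> takes an entry of the tuple, each other member over \<open>x\<close> and \<open>j\<close> moves to the code of its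
  predecessor.
\<close>

definition member :: "nat set \<Rightarrow> index \<Rightarrow> nat \<Rightarrow> nat \<Rightarrow> nat \<Rightarrow> nat" where
  "member J x j r n =
     (if used J x j n then (case r of 0 \<Rightarrow> fst (x n) ! j | Suc r' \<Rightarrow> code x j r' n)
      else code x j r n)"

definition family :: "nat set \<Rightarrow> (nat \<Rightarrow> nat) set" where
  "family J = {member J x j r | x j r. True}"

text \<open>
  The smaller of the two slots guessed that coordinate \<open>j\<close> is incoherent with all later branch
  points, and the larger one lies on the branch, hence confirms the guess.
\<close>

lemma used_pair:
  assumes "used J x j m" "used J x j n" "m \<noteq> n"
  shows "\<not> coherent m (fst (x m) ! j) n (fst (x n) ! j)"
proof -
  let ?h = "fst \<circ> x"
  have main: "\<not> coherent (slot ?h k) (?h (slot ?h k) ! j) (slot ?h l) (?h (slot ?h l) ! j)"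
    if "k < l" "on_path x l" "snd (x k) = Some c" "j < length c" "\<not> c ! j" for k l c
  proof -
    have "color ?h k l = c"
      using that on_path_follows[of x l] by (auto simp: follows_def)
    with that show ?thesis
      by (auto simp: color_def)
  qed
  obtain k c where k: "m = slot ?h k" "on_path x k" "snd (x k) = Some c" "j < length c" "\<not> c ! j"
    using assms(1) by (auto simp: used_def)
  obtain l d where l: "n = slot ?h l" "on_path x l" "snd (x l) = Some d" "j < length d" "\<not> d ! j"
    using assms(2) by (auto simp: used_def)
  have "k \<noteq> l" using assms(3) k(1) l(1) by auto
  then show ?thesis
    using main[OF _ l(2) k(3-5)] main[OF _ k(2) l(3-5)] coherent_sym k(1) l(1)
    by (cases k l rule: linorder_cases) auto
qed

text \<open>
  A guess is verified only by a later point of the branch.  The last used slot may therefore carry a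
  wrong colour, with a repeated entry, but among infinitely many slots all others are correct.
\<close>

lemma used_value_not_repeated:
  assumes "infinite {n. used J x j n \<and> P n}"
  shows "\<exists>n. used J x j n \<and> P n \<and> j < length (fst (x n)) \<and>
             fst (x n) ! j \<notin> set (take j (fst (x n)))"
proof -
  let ?h = "fst \<circ> x"
  let ?L = "{l. on_path x l \<and> used J x j (slot ?h l) \<and> P (slot ?h l)}"
  have "{n. used J x j n \<and> P n} \<subseteq> slot ?h ` ?L"
    by (auto simp: used_def image_def)
  with assms have "infinite ?L"
    by (meson finite_imageI finite_subset)
  then obtain k where k: "k \<in> ?L" and "\<exists>l\<in>?L. k < l"
    by (metis (no_types, lifting) infinite_nat_iff_unbounded)
  then obtain l where l: "l \<in> ?L" "k < l" by blast
  obtain c where c: "snd (x k) = Some c" "j < length c" "\<not> c ! j"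
    using k by (auto simp: used_def slot_eq_iff)
  have "color ?h k l = c"
    using l c on_path_follows[of x l] by (auto simp: follows_def)
  with c k show ?thesis
    by (intro exI[of _ "slot ?h k"]) (auto simp: color_def)
qed

lemma finite_used_code:
  "finite {n. used J x j n \<and> fst (x n) ! j = code y i r n}"
proof (rule ccontr)
  assume "infinite {n. used J x j n \<and> fst (x n) ! j = code y i r n}"
  then obtain m n where "used J x j m" "fst (x m) ! j = code y i r m"
    "used J x j n" "fst (x n) ! j = code y i r n" "m < n"
    by (auto simp: infinite_nat_iff_unbounded) blast
  with used_pair[of J x j m n] show False
    by (auto simp: coherent_def)
qed

lemma used_common:
  assumes "infinite {n. used J x j n \<and> used J y i n}"
  shows "x = y"
  by (rule paths_almost_disjoint, rule infinite_super[OF _ assms]) (auto simp: used_def)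

section \<open>Members are eventually different\<close>

text \<open>
  The places of agreement are split by which of the two members is substituted there.  Two codes agree infinitely often only for equal
  parameters, an entry equals the codes of given parameters at most once, and two
  substitutions take place infinitely often together only over the same \<open>x\<close>.
\<close>

lemma family_eventually_different:
  assumes inf: "infinite {n. member J x j r n = member J y i s n}"
  shows "x = y \<and> j = i \<and> r = s"
proof -
  let ?A = "{n. member J x j r n = member J y i s n}"
  let ?U = "{n. used J x j n}" and ?V = "{n. used J y i n}"
  (* If only one member is substituted, then agreement forces equal x and j, but these alone
     determine where a member is substituted, so such agreements cannot be infinitely many. *)
  have one_used: "x = y \<and> j = i"
    if A: "infinite {n. used J x j n \<and> \<not> used J y i n \<and> member J x j r n = member J y i s n}"
    for x y j i r s
  proof (cases r)
    case 0
    have "infinite {n. used J x j n \<and> fst (x n) ! j = code y i s n}"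
      by (rule infinite_super[OF _ A]) (auto simp: member_def 0)
    then show ?thesis using finite_used_code by blast
  next
    case (Suc r')
    have "infinite {n. code x j r' n = code y i s n}"
      by (rule infinite_super[OF _ A]) (auto simp: member_def Suc)
    then show ?thesis using codes_agree_infinitely by blast
  qed
  have "infinite ((?A - ?U - ?V) \<union> (?A \<inter> ?U - ?V) \<union> (?A \<inter> ?V - ?U) \<union> (?A \<inter> ?U \<inter> ?V))"
    by (rule infinite_super[OF _ inf]) blast
  then consider "infinite (?A - ?U - ?V)" | "infinite (?A \<inter> ?U - ?V)"
    | "infinite (?A \<inter> ?V - ?U)" | "infinite (?A \<inter> ?U \<inter> ?V)"
    unfolding finite_Un by blast
  then show ?thesis
  proof cases
    case 1
    have "infinite {n. code x j r n = code y i s n}"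
      by (rule infinite_super[OF _ 1]) (auto simp: member_def)
    then show ?thesis using codes_agree_infinitely by blast
  next
    case 2
    have "infinite {n. used J x j n \<and> \<not> used J y i n \<and> member J x j r n = member J y i s n}"
      by (rule infinite_super[OF _ 2]) auto
    then have "x = y \<and> j = i" by (rule one_used)
    then have "?A \<inter> ?U - ?V = {}" by auto
    with 2 show ?thesis by (metis finite.emptyI)
  next
    case 3
    have "infinite {n. used J y i n \<and> \<not> used J x j n \<and> member J y i s n = member J x j r n}"
      by (rule infinite_super[OF _ 3]) auto
    then have "y = x \<and> i = j" by (rule one_used)
    then have "?A \<inter> ?V - ?U = {}" by auto
    with 3 show ?thesis by (metis finite.emptyI)
  next
    case 4
    have "infinite {n. used J x j n \<and> used J y i n}"
      by (rule infinite_super[OF _ 4]) auto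
    then have xy: "x = y" by (rule used_common)
    show ?thesis
    proof (cases r; cases s)
      assume rs: "r = 0" "s = 0"
      have False if neq: "i' < j'" and
        inf: "infinite {n. used J x j' n \<and> used J x i' n \<and> fst (x n) ! j' = fst (x n) ! i'}" for i' j'
      proof -
        obtain n where "j' < length (fst (x n))" "fst (x n) ! j' = fst (x n) ! i'"
          "fst (x n) ! j' \<notin> set (take j' (fst (x n)))"
          using used_value_not_repeated[OF inf] by auto
        with neq show False
          by (auto simp: in_set_conv_nth)
      qed
      note * = this
      have "infinite {n. used J x j n \<and> used J x i n \<and> fst (x n) ! j = fst (x n) ! i}"
        by (rule infinite_super[OF _ 4]) (auto simp: member_def rs xy)
      moreover have "infinite {n. used J x i n \<and> used J x j n \<and> fst (x n) ! i = fst (x n) ! j}"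
        by (rule infinite_super[OF _ 4]) (auto simp: member_def rs xy)
      ultimately have "j = i" using *[of i j] *[of j i] by (cases i j rule: linorder_cases) auto
      with xy rs show ?thesis by simp
    next
      fix s' assume rs: "r = 0" "s = Suc s'"
      have "infinite {n. used J x j n \<and> fst (x n) ! j = code y i s' n}"
        by (rule infinite_super[OF _ 4]) (auto simp: member_def rs)
      then show ?thesis using finite_used_code by blast
    next
      fix r' assume rs: "r = Suc r'" "s = 0"
      have "infinite {n. used J y i n \<and> fst (y n) ! i = code x j r' n}"
        by (rule infinite_super[OF _ 4]) (auto simp: member_def rs)
      then show ?thesis using finite_used_code by blast
    next
      fix r' s' assume rs: "r = Suc r'" "s = Suc s'"
      have "infinite {n. code x j r' n = code y i s' n}"
        by (rule infinite_super[OF _ 4]) (auto simp: member_def rs)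
      then show ?thesis using codes_agree_infinitely rs by blast
    qed
  qed
qed


section \<open>Catching tuples\<close>

text \<open>
  On an infinite set of branch points with a constant colour, the coordinates are caught one after
  the other, each time on an infinite subset of the previous set of places.
\<close>

lemma family_catches:
  assumes J: "{..<N} \<subseteq> J" and len: "\<And>n. length (h n) = N"
  shows "\<exists>fs. length fs = N \<and> set fs \<subseteq> family J \<and> infinite {n. h n = map (\<lambda>f. f n) fs}"
proof -
  obtain x where fst_x: "fst \<circ> x = h" and path: "infinite {l. on_path x l}"
    using path_over by blast
  have later: "snd (x k) = Some (color h k l)" if k: "on_path x k" and l: "on_path x l" and kl: "k < l" for k l
  proof -
    obtain c where "snd (x k) = Some c"
      using on_path_Some[OF k] by blast
    moreover have "follows x l"
      using l by (rule on_path_follows)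
    ultimately show ?thesis
      using kl fst_x by (simp add: follows_def)
  qed
  have "snd (x k) \<in> Some ` {c. set c \<subseteq> UNIV \<and> length c = N}" if "on_path x k" for k
  proof -
    obtain l where "on_path x l" "k < l"
      using path by (auto simp: infinite_nat_iff_unbounded)
    from later[OF that this] show ?thesis by (auto simp: color_def len)
  qed
  then have "(\<lambda>l. snd (x l)) ` {l. on_path x l} \<subseteq> Some ` {c. set c \<subseteq> UNIV \<and> length c = N}"
    by auto
  then have fin: "finite ((\<lambda>l. snd (x l)) ` {l. on_path x l})"
    by (rule finite_subset) (intro finite_imageI finite_lists_length_eq finite)
  obtain k0 where k0: "on_path x k0"
    and K_inf: "infinite {l \<in> {l. on_path x l}. snd (x l) = snd (x k0)}"
    using pigeonhole_infinite[OF path fin] by auto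
  obtain C where C: "snd (x k0) = Some C"
    using on_path_Some[OF k0] by blast
  define K where "K = {l. on_path x l \<and> snd (x l) = Some C}"
  have K: "infinite K"
    using K_inf C by (simp add: K_def)
  define M where "M = slot h ` K"
  have M: "infinite M"
    unfolding M_def using K inj_slot by (metis finite_image_iff inj_on_subset subset_UNIV)
  have C_color: "color h k l = C" if "k \<in> K" "l \<in> K" "k < l" for k l
    using later[of k l] that by (auto simp: K_def)
  have len_C: "length C = N"
  proof -
    obtain k where "k \<in> K" using K by fastforce
    moreover then obtain l where "l \<in> K" "k < l"
      using K by (auto simp: infinite_nat_iff_unbounded)
    ultimately have "color h k l = C" by (rule C_color)
    then show ?thesis by (auto simp: color_def len)
  qed
  (* A false entry of C means substitution everywhere on M, and a true one means coherence of all
     entries that do not repeat an earlier coordinate. *)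
  have M_used: "used J x i n" if "n \<in> M" "i < N" "\<not> C ! i" for n i
    using that J len_C by (auto simp: used_def M_def K_def fst_x)
  have M_coherent: "coherent m (h m ! i) n (h n ! i)"
    if mn: "m \<in> M" "n \<in> M" "m \<noteq> n" "i < N" "C ! i"
      "h m ! i \<notin> set (take i (h m))" "h n ! i \<notin> set (take i (h n))" for m n i
  proof -
    obtain k l where kl: "m = slot h k" "k \<in> K" "n = slot h l" "l \<in> K"
      using mn(1,2) by (auto simp: M_def)
    with mn(3) consider "k < l" | "l < k" by (cases k l rule: linorder_cases) auto
    then show ?thesis
    proof cases
      case 1
      with C_color[OF kl(2,4)] mn kl show ?thesis by (auto simp: color_def len)
    next
      case 2
      with C_color[OF kl(4,2)] mn kl have "coherent n (h n ! i) m (h m ! i)"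
        by (auto simp: color_def len)
      then show ?thesis by (rule coherent_sym)
    qed
  qed
  have "\<exists>fs A. length fs = i \<and> set fs \<subseteq> family J \<and> A \<subseteq> M \<and> infinite A \<and>
               (\<forall>n\<in>A. \<forall>j<i. h n ! j = (fs ! j) n)" if "i \<le> N" for i
    using that
  proof (induction i)
    case 0
    with M show ?case by (intro exI[of _ "[]"] exI[of _ M]) auto
  next
    case (Suc i)
    then obtain fs A where fs: "length fs = i" "set fs \<subseteq> family J" and A: "A \<subseteq> M" "infinite A"
      and catch: "\<And>n j. n \<in> A \<Longrightarrow> j < i \<Longrightarrow> h n ! j = (fs ! j) n"
      by auto
    have "\<exists>f\<in>family J. \<exists>B\<subseteq>A. infinite B \<and> (\<forall>n\<in>B. h n ! i = f n)"
    proof (cases "C ! i")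
      case False
      have "h n ! i = member J x i 0 n" if "n \<in> A" for n
        using M_used[of n i] that A(1) False Suc.prems fst_x by (auto simp: member_def)
      then show ?thesis
        using A(2) by (intro bexI[of _ "member J x i 0"] exI[of _ A]) (auto simp: family_def)
    next
      case True
      define D where "D = {n \<in> A. h n ! i \<in> set (take i (h n))}"
      show ?thesis
      proof (cases "finite D")
        case False
        (* The coordinate infinitely often repeats an earlier one, so a member that is already
           chosen catches it. *)
        have "\<exists>j<i. h n ! i = h n ! j" if "n \<in> D" for n
          using that by (auto simp: D_def in_set_conv_nth)
        then obtain q where q: "\<And>n. n \<in> D \<Longrightarrow> q n < i" "\<And>n. n \<in> D \<Longrightarrow> h n ! i = h n ! q n"
          by metis
        have "finite (q ` D)"
          by (rule finite_subset[of _ "{..<i}"]) (use q(1) in auto)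
        then obtain d where d: "d \<in> D" "infinite {n \<in> D. q n = q d}"
          using pigeonhole_infinite[OF False] by auto
        have "h n ! i = (fs ! q d) n" if "n \<in> {n \<in> D. q n = q d}" for n
          using that q(2)[of n] q(1)[of d] d(1) catch[of n "q d"] by (auto simp: D_def)
        moreover have "fs ! q d \<in> family J"
          using fs q(1)[of d] d(1) by auto
        ultimately show ?thesis
          using d(2) by (intro bexI[of _ "fs ! q d"] exI[of _ "{n \<in> D. q n = q d}"])
            (auto simp: D_def)
      next
        case fin_D: True
        (* Otherwise its entries are eventually codes of one triple y, j, r, and this code is the
           value of the member with parameter r or, where that one is shifted, of Suc r. *)
        have AD: "infinite (A - D)"
          using A(2) fin_D by (rule Diff_infinite_finite[rotated])
        have "\<exists>y j r. \<forall>n\<in>A - D. h n ! i = code y j r n"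
          using AD
        proof (rule coherent_limit)
          fix m n assume "m \<in> A - D" "n \<in> A - D" "m < n"
          then show "coherent m (h m ! i) n (h n ! i)"
            using M_coherent[of m n i] A(1) True Suc.prems by (auto simp: D_def)
        qed
        then obtain y j r where y: "\<And>n. n \<in> A - D \<Longrightarrow> h n ! i = code y j r n"
          by blast
        define S where "S = {n \<in> A - D. used J y j n}"
        show ?thesis
        proof (cases "finite S")
          case True
          then have "infinite (A - D - S)"
            using AD by (rule Diff_infinite_finite)
          moreover have "h n ! i = member J y j r n" if "n \<in> A - D - S" for n
            using that y[of n] by (auto simp: S_def member_def)
          ultimately show ?thesis
            by (intro bexI[of _ "member J y j r"] exI[of _ "A - D - S"]) (auto simp: family_def)
        next
          case False
          have "h n ! i = member J y j (Suc r) n" if "n \<in> S" for n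
            using that y[of n] by (auto simp: S_def member_def)
          with False show ?thesis
            by (intro bexI[of _ "member J y j (Suc r)"] exI[of _ S]) (auto simp: family_def S_def)
        qed
      qed
    qed
    then obtain f B where f: "f \<in> family J" "B \<subseteq> A" "infinite B" "\<And>n. n \<in> B \<Longrightarrow> h n ! i = f n"
      by blast
    show ?case
    proof (intro exI conjI ballI allI impI)
      show "length (fs @ [f]) = Suc i" "set (fs @ [f]) \<subseteq> family J" "B \<subseteq> M" "infinite B"
        using fs f A by auto
      fix n j assume "n \<in> B" "j < Suc i"
      then show "h n ! j = ((fs @ [f]) ! j) n"
        using f(2) f(4)[of n] catch[of n j] fs(1) by (auto simp: nth_append less_Suc_eq)
    qed
  qed
  from this[OF le_refl] obtain fs A where fs: "length fs = N" "set fs \<subseteq> family J" and A: "infinite A"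
    and catch: "\<And>n j. n \<in> A \<Longrightarrow> j < N \<Longrightarrow> h n ! j = (fs ! j) n"
    by blast
  have "infinite {n. h n = map (\<lambda>f. f n) fs}"
    by (rule infinite_super[OF _ A]) (auto simp: list_eq_iff_nth_eq len fs catch)
  with fs show ?thesis by blast
qed

section \<open>The family is closed\<close>

lemma color_cong:
  assumes eq: "\<And>i. i < M \<Longrightarrow> h' i = h i" and M: "slot h k < M" "slot h l < M"
  shows "color h' k l = color h k l"
proof -
  have "slot h' k = slot h k" "slot h' l = slot h l"
    using less_slot[of k h] less_slot[of l h] M by (auto intro!: slot_cong eq)
  then show ?thesis
    using eq[OF M(1)] eq[OF M(2)] by (simp add: color_def)
qed

lemma member_locally_constant:
  "\<exists>M. \<forall>y. (\<forall>i<M. y i = x i) \<longrightarrow> member J y j r n = member J x j r n"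
proof (intro exI allI impI)
  let ?h = "fst \<circ> x"
  (* Deciding whether n is a used slot requires the colours of pairs up to n, and these
     depend on the entries of x at the slots themselves, which may lie beyond n. *)
  define M where "M = Suc (n + (\<Sum>k\<le>n. slot ?h k))"
  fix y assume y: "\<forall>i<M. y i = x i"
  have slot_M: "slot ?h k < M" if "k \<le> n" for k
    using member_le_sum[of k "{..n}" "slot ?h"] that by (auto simp: M_def)
  have n_M: "n < M"
    by (simp add: M_def)
  have slot_eq: "slot (fst \<circ> y) k = slot ?h k" if "k \<le> n" for k
    by (rule slot_cong) (use y n_M that in auto)
  have color_eq: "color (fst \<circ> y) k l = color ?h k l" if "k \<le> n" "l \<le> n" for k l
    by (rule color_cong[of M]) (use y slot_M that in auto)
  have follows_eq: "follows y k = follows x k" if "k \<le> n" for k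
    unfolding follows_def using that y n_M color_eq by auto
  have path_eq: "on_path y l = on_path x l" if "l \<le> n" for l
    unfolding on_path_def using that y n_M follows_eq by auto
  have slot_bound: "l \<le> n" if "n = slot g l" for g l
    using less_slot[of l g] that by simp
  have "(n = slot (fst \<circ> y) l \<and> on_path y l \<and> snd (y l) = Some c \<and> j < length c \<and> \<not> c ! j) =
        (n = slot ?h l \<and> on_path x l \<and> snd (x l) = Some c \<and> j < length c \<and> \<not> c ! j)" for l c
  proof (cases "l \<le> n")
    case True
    then have "y l = x l" using y n_M by simp
    with True show ?thesis by (simp only: slot_eq path_eq)
  next
    case False
    then show ?thesis using slot_bound by blast
  qed
  then have "used J y j n = used J x j n"
    unfolding used_def by simp
  moreover have "code y j s n = code x j s n" for s
    using y n_M by (auto simp: code_eq_iff)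
  ultimately show "member J y j r n = member J x j r n"
    using y n_M by (auto simp: member_def split: nat.splits)
qed

lemma closed_familyI:
  assumes "\<And>g. (\<And>n. \<exists>f\<in>F. \<forall>k<n. f k = g k) \<Longrightarrow> g \<in> F"
  shows "closed_family F"
proof -
  let ?T = "product_topology (\<lambda>_::nat. discrete_topology (UNIV :: nat set)) UNIV"
  have "openin ?T (- F)"
  proof (subst openin_subopen, rule)
    fix g assume "g \<in> - F"
    then obtain n where "\<not> (\<exists>f\<in>F. \<forall>k<n. f k = g k)"
      using assms[of g] by (meson ComplD)
    then have n: "\<exists>k<n. f k \<noteq> g k" if "f \<in> F" for f
      using that by blast
    let ?U = "PiE UNIV (\<lambda>k. if k < n then {g k} else UNIV)"
    have "finite {k. k < n \<and> {g k} \<noteq> UNIV}"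
      by simp
    then have "openin ?T ?U"
      by (auto simp: openin_PiE_gen)
    moreover have "g \<in> ?U" by auto
    moreover have "?U \<subseteq> - F"
    proof
      fix f assume f: "f \<in> ?U"
      have "f k = g k" if "k < n" for k
        using PiE_mem[OF f, of k] that by simp
      with n[of f] show "f \<in> - F" by blast
    qed
    ultimately show "\<exists>U. openin ?T U \<and> g \<in> U \<and> U \<subseteq> - F" by blast
  qed
  then show ?thesis
    by (simp add: closed_family_def closedin_def Compl_eq_Diff_UNIV)
qed

text \<open>
  If members approximate \<open>g\<close>, then the even places of \<open>g\<close> show that their parameters converge,
  and the member at the limit agrees with \<open>g\<close> because members depend continuously on \<open>x\<close>.
\<close>

lemma closed_family_family: "closed_family (family J)"
proof (rule closed_familyI)
  fix g assume "\<And>n. \<exists>f\<in>family J. \<forall>k<n. f k = g k"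
  then have "\<exists>x j r. \<forall>k<n. member J x j r k = g k" for n
    unfolding family_def by blast
  then obtain X I R where approx: "\<And>n k. k < n \<Longrightarrow> member J (X n) (I n) (R n) k = g k"
    by metis
  have code_g: "code (X n) (I n) (R n) (2 * m) = g (2 * m)" if "2 * m < n" for m n
  proof -
    have "\<not> used J (X n) (I n) (2 * m)"
      using odd_slot by (metis dvd_triv_left used_def)
    then show ?thesis
      using approx[OF that] by (simp add: member_def)
  qed
  (* The code at place 2 * i + 2 contains entry i, and agreement below 2 * i + 3 covers it. *)
  define x where "x i = X (2 * i + 3) i" for i
  have X: "X n i = x i" if "2 * i + 3 \<le> n" for n i
  proof -
    let ?m = "2 * i + 3"
    have "code (X n) (I n) (R n) (2 * (i + 1)) = code (X ?m) (I ?m) (R ?m) (2 * (i + 1))"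
      using code_g[of "i + 1" n] code_g[of "i + 1" ?m] that by simp
    then show ?thesis
      by (simp add: code_eq_iff x_def)
  qed
  have IR: "I n = I 1 \<and> R n = R 1" if "0 < n" for n
  proof -
    have "code (X n) (I n) (R n) 0 = code (X 1) (I 1) (R 1) 0"
      using code_g[of 0 n] code_g[of 0 1] that by simp
    then show ?thesis
      by (simp add: code_eq_iff)
  qed
  have "g k = member J x (I 1) (R 1) k" for k
  proof -
    obtain M where M: "\<And>y. (\<forall>i<M. y i = x i) \<Longrightarrow>
        member J y (I 1) (R 1) k = member J x (I 1) (R 1) k"
      using member_locally_constant by metis
    let ?n = "k + 2 * M + 3"
    have "member J (X ?n) (I 1) (R 1) k = member J x (I 1) (R 1) k"
      by (rule M) (auto intro: X)
    moreover have "member J (X ?n) (I 1) (R 1) k = g k"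
      using approx[of k ?n] IR[of ?n] by simp
    ultimately show ?thesis by simp
  qed
  then show "g \<in> family J"
    unfolding family_def by blast
qed

section \<open>Productivity\<close>

text \<open>
  For infinite \<open>A\<close> a function agrees with itself infinitely often, so functions inside and
  outside the family need not be distinguished.
\<close>

lemma med_family_iff:
  assumes "infinite A"
  shows "med_family A B F \<longleftrightarrow>
    ed_family A B F \<and> (\<forall>h\<in>A \<rightarrow>\<^sub>E B. \<exists>f\<in>F. infinite (agreement A h f))"
proof (intro iffI conjI ballI)
  assume med: "med_family A B F"
  then show ed: "ed_family A B F"
    by (simp add: med_family_def)
  fix h assume h: "h \<in> A \<rightarrow>\<^sub>E B"
  show "\<exists>f\<in>F. infinite (agreement A h f)"
  proof (cases "h \<in> F")
    case True
    then show ?thesis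
      using assms by (intro bexI[of _ h]) (auto simp: agreement_def)
  next
    case False
    then have "\<not> ed_family A B (insert h F)"
      using med unfolding med_family_def by blast
    then obtain f where f: "f \<in> F" "\<not> (eventually_different A h f \<and> eventually_different A f h)"
      using ed h by (auto simp: ed_family_def pairwise_insert)
    have "agreement A f h = agreement A h f"
      by (auto simp: agreement_def)
    with f show ?thesis
      by (auto simp: eventually_different_def)
  qed
next
  assume F: "ed_family A B F \<and> (\<forall>h\<in>A \<rightarrow>\<^sub>E B. \<exists>f\<in>F. infinite (agreement A h f))"
  have "G \<subseteq> F" if G: "ed_family A B G" "F \<subseteq> G" for G
  proof
    fix g assume g: "g \<in> G"
    then have "g \<in> A \<rightarrow>\<^sub>E B"
      using G by (auto simp: ed_family_def)
    then obtain f where f: "f \<in> F" "infinite (agreement A g f)"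
      using F by blast
    then have "g = f"
      using G g unfolding ed_family_def pairwise_def eventually_different_def by blast
    with f show "g \<in> F" by simp
  qed
  with F show "med_family A B F"
    unfolding med_family_def by blast
qed

lemma ed_family_power:
  assumes "ed_family A B F"
  shows "ed_family A (tuples n B) (family_power A F n)"
  unfolding ed_family_def
proof
  show "family_power A F n \<subseteq> A \<rightarrow>\<^sub>E tuples n B"
    using assms by (fastforce simp: family_power_def fun_product_def tuples_def ed_family_def)
  show "pairwise (eventually_different A) (family_power A F n)"
  proof (rule pairwiseI)
    fix p q assume "p \<in> family_power A F n" "q \<in> family_power A F n" and neq: "p \<noteq> q"
    then obtain fs gs where p: "p = fun_product A fs" and fs: "length fs = n" "set fs \<subseteq> F"
      and q: "q = fun_product A gs" and gs: "length gs = n" "set gs \<subseteq> F"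
      by (auto simp: family_power_def tuples_def)
    from neq p q have "fs \<noteq> gs" by auto
    then obtain i where i: "i < n" "fs ! i \<noteq> gs ! i"
      using fs gs by (auto simp: list_eq_iff_nth_eq)
    then have "eventually_different A (fs ! i) (gs ! i)"
      using assms fs gs by (auto simp: ed_family_def pairwise_def subset_iff)
    moreover have "agreement A p q \<subseteq> agreement A (fs ! i) (gs ! i)"
      using i fs gs by (auto simp: agreement_def p q fun_product_def list_eq_iff_nth_eq)
    ultimately show "eventually_different A p q"
      unfolding eventually_different_def by (rule finite_subset[rotated])
  qed
qed

lemma ed_family_family: "ed_family UNIV UNIV (family J)"
  unfolding ed_family_def
proof
  show "pairwise (eventually_different UNIV) (family J)"
  proof (rule pairwiseI)
    fix f g assume "f \<in> family J" "g \<in> family J" and neq: "f \<noteq> g"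
    then obtain x j r y i s where fg: "f = member J x j r" "g = member J y i s"
      by (auto simp: family_def)
    show "eventually_different UNIV f g"
    proof (rule ccontr)
      assume "\<not> ?thesis"
      then have "infinite {n. member J x j r n = member J y i s n}"
        by (simp add: eventually_different_def agreement_def fg)
      from family_eventually_different[OF this] neq fg show False by simp
    qed
  qed
qed auto

lemma family_productive:
  assumes "{..<n} \<subseteq> J" "n \<ge> 1"
  shows "productive n UNIV UNIV (family J)"
  unfolding productive_def med_family_iff[OF infinite_UNIV_nat]
proof (intro conjI ballI ed_family_power ed_family_family)
  fix h :: "nat \<Rightarrow> nat list" assume "h \<in> UNIV \<rightarrow>\<^sub>E tuples n UNIV"
  then have "length (h k) = n" for k
    by (auto simp: tuples_def PiE_iff)
  from family_catches[of n J h, OF assms(1) this] obtain fs where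
    fs: "length fs = n" "set fs \<subseteq> family J" "infinite {k. h k = map (\<lambda>f. f k) fs}"
    by auto
  then have "fun_product UNIV fs \<in> family_power UNIV (family J) n"
    by (simp add: family_power_def tuples_def)
  moreover have "agreement UNIV h (fun_product UNIV fs) = {k. h k = map (\<lambda>f. f k) fs}"
    by (auto simp: fun_product_def agreement_def)
  ultimately show "\<exists>f\<in>family_power UNIV (family J) n. infinite (agreement UNIV h f)"
    using fs(3) by metis
next
  fix h :: "nat \<Rightarrow> nat"
  have "{..<1} \<subseteq> J" using assms by auto
  from family_catches[OF this, of "\<lambda>k. [h k]"] obtain f where
    "f \<in> family J" "infinite {k. h k = f k}"
    by (auto simp: length_Suc_conv)
  then show "\<exists>f\<in>family J. infinite (agreement UNIV h f)"
    by (auto simp: agreement_def)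
qed

text \<open>
  A code determines its place, so members can follow the constants \<open>0, \<dots>, n\<close> only by
  substitution.  Doing so at common slots forces the same \<open>x\<close>, over which there are just \<open>n\<close>
  coordinates.
\<close>

lemma family_not_productive: "\<not> productive (Suc n) UNIV UNIV (family {..<n})"
proof
  let ?J = "{..<n}"
  assume "productive (Suc n) UNIV UNIV (family ?J)"
  then have "\<forall>h\<in>UNIV \<rightarrow>\<^sub>E tuples (Suc n) UNIV.
      \<exists>f\<in>family_power UNIV (family ?J) (Suc n). infinite (agreement UNIV h f)"
    by (simp add: productive_def med_family_iff)
  moreover have "(\<lambda>_. [0..<Suc n]) \<in> UNIV \<rightarrow>\<^sub>E tuples (Suc n) UNIV"
    by (auto simp: tuples_def)
  ultimately obtain fs where fs: "length fs = Suc n" "set fs \<subseteq> family ?J"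
    and inf: "infinite {k. [0..<Suc n] = map (\<lambda>f. f k) fs}"
    by (fastforce simp: family_power_def tuples_def fun_product_def agreement_def)
  define A where "A = {k. [0..<Suc n] = map (\<lambda>f. f k) fs}"
  have A_val: "(fs ! i) k = i" if "k \<in> A" "i \<le> n" for k i
    using that fs(1) unfolding A_def list_eq_iff_nth_eq by (auto simp del: upt_Suc)
  have "\<exists>x j r. fs ! i = member ?J x j r" if "i \<le> n" for i
    using that fs by (auto simp: family_def subset_iff in_set_conv_nth less_Suc_eq_le)
  then obtain X I R where mem: "\<And>i. i \<le> n \<Longrightarrow> fs ! i = member ?J (X i) (I i) (R i)"
    by metis
  (* At these finitely many places the constant happens to be a code; R i - 1 accounts for a
     shifted member. *)
  define bad where "bad i = {k. code (X i) (I i) (R i) k = i} \<union>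
      {k. code (X i) (I i) (R i - 1) k = i}" for i
  have "finite {k. code x j r k = v}" for x j r v
  proof -
    have "{k. code x j r k = v} \<subseteq> {k}" if "code x j r k = v" for k
      using that by (auto simp: code_eq_iff)
    then show ?thesis
      by (cases "{k. code x j r k = v} = {}") (auto intro: finite_subset)
  qed
  then have "finite (\<Union>i\<le>n. bad i)"
    by (simp add: bad_def)
  then have B: "infinite (A - (\<Union>i\<le>n. bad i))" (is "infinite ?B")
    using inf unfolding A_def by (rule Diff_infinite_finite)
  have B_used: "used ?J (X i) (I i) k \<and> R i = 0" if "k \<in> ?B" "i \<le> n" for k i
  proof -
    have "member ?J (X i) (I i) (R i) k = i" "k \<notin> bad i"
      using that A_val[of k i] mem[of i] by auto
    then show ?thesis
      by (auto simp: member_def bad_def split: if_splits nat.splits)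
  qed
  have same: "X i = X 0" if "i \<le> n" for i
    by (rule used_common, rule infinite_super[OF _ B]) (use B_used that in auto)
  obtain k where k: "k \<in> ?B"
    using infinite_imp_nonempty[OF B] by blast
  have "inj_on I {..n}"
  proof (rule inj_onI)
    fix i i' assume i: "i \<in> {..n}" "i' \<in> {..n}" "I i = I i'"
    have "fs ! l = member ?J (X 0) (I l) 0" if "l \<le> n" for l
      using mem[OF that] same[OF that] B_used[OF k that] by (simp only:)
    with i have eq: "fs ! i = fs ! i'" by simp
    have "i = (fs ! i) k"
      by (rule A_val[symmetric]) (use k i(1) in auto)
    also have "\<dots> = (fs ! i') k"
      by (simp only: eq)
    also have "\<dots> = i'"
      by (rule A_val) (use k i(2) in auto)
    finally show "i = i'" .
  qed
  moreover have "I i \<in> {..<n}" if "i \<le> n" for i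
    using B_used[OF k that] unfolding used_def by blast
  then have "I ` {..n} \<subseteq> {..<n}"
    by auto
  ultimately show False
    using card_inj_on_le[of I "{..n}" "{..<n}"] by simp
qed

theorem corollary5p2:
  shows "(\<forall>n\<ge>1. \<exists>F :: (nat \<Rightarrow> nat) set.
            closed_family F \<and> productive n UNIV UNIV F \<and> \<not> productive (n + 1) UNIV UNIV F) \<and>
         (\<exists>F :: (nat \<Rightarrow> nat) set.
            closed_family F \<and> finitely_productive UNIV UNIV F)"
proof (intro conjI allI impI)
  fix n :: nat assume "n \<ge> 1"
  then show "\<exists>F :: (nat \<Rightarrow> nat) set.
      closed_family F \<and> productive n UNIV UNIV F \<and> \<not> productive (n + 1) UNIV UNIV F"
    using closed_family_family family_productive[of n "{..<n}"] family_not_productive[of n]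
    by (intro exI[of _ "family {..<n}"]) simp
next
  show "\<exists>F :: (nat \<Rightarrow> nat) set. closed_family F \<and> finitely_productive UNIV UNIV F"
    using closed_family_family family_productive[of _ UNIV]
    by (intro exI[of _ "family UNIV"]) (simp add: finitely_productive_def)
qed

end
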